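(* Let $T$ be an infinite binary tree and let the weights on $T$ be $\sigma(t)=1$, $\alpha(t)=(|t|+1)^{-1}$, $t\in T$. Then there exists a finite positive constant $c$ such that for all positive integers $n$ $$e_n\big(V_{\alpha,\sigma}:\ell_1(T)\to\ell_2(T)\big)\le c\,n^{-1/2}.$$
   Context: The infinite binary tree is the rooted tree in which every element has exactly two offspring. $t\preceq s$ means that $t$ lies on the path from the root to $s$ (with $t=s$ allowed), $t\prec s$ means $t\preceq s$, $t\neq s$, and the order of $t$ is $|t|:=\#\{v\in T: v\prec t\}$ (so the root has order $0$). For weights $\alpha,\sigma:T\to(0,\infty)$ the weighted summation operator is $$(V_{\alpha,\sigma}\mu)(t):=\alpha(t)\sum_{s\succeq t}\sigma(s)\mu(s),\qquad t\in T,\ \mu\in\ell_1(T).$$ For a bounded operator $V:X\to Y$ between Banach spaces, the (dyadic) entropy number $e_n(V)$ is the infimum of all $\varepsilon>0$ such that $\{Vx:\|x\|_X\le 1\}$ is covered by at most $2^{n-1}$ open balls of radius $\varepsilon$ in $Y$. *)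

theory Defs
  imports "HOL-Analysis.Analysis" "HOL-Library.Function_Algebras" "HOL-Library.Sublist"
begin

text \<open>
  The vertex set of a tree is the whole type \<open>'a\<close>; \<open>E t s\<close> means that \<open>s\<close> is an offspring of \<open>t\<close>.
\<close>

definition path_to :: "('a \<Rightarrow> 'a \<Rightarrow> bool) \<Rightarrow> 'a \<Rightarrow> 'a \<Rightarrow> 'a list \<Rightarrow> bool" where
  "path_to E r t p \<longleftrightarrow> p \<noteq> [] \<and> hd p = r \<and> last p = t \<and> successively E p"

definition rooted_tree :: "('a \<Rightarrow> 'a \<Rightarrow> bool) \<Rightarrow> 'a \<Rightarrow> bool" where
  "rooted_tree E r \<longleftrightarrow> (\<forall>t. \<exists>!p. path_to E r t p)"

definition infinite_binary_tree :: "('a \<Rightarrow> 'a \<Rightarrow> bool) \<Rightarrow> 'a \<Rightarrow> bool" where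
  "infinite_binary_tree E r \<longleftrightarrow> rooted_tree E r \<and> (\<forall>t. card {s. E t s} = 2)"

definition tree_le :: "('a \<Rightarrow> 'a \<Rightarrow> bool) \<Rightarrow> 'a \<Rightarrow> 'a \<Rightarrow> 'a \<Rightarrow> bool" where
  "tree_le E r t s \<longleftrightarrow> (\<exists>p. path_to E r s p \<and> t \<in> set p)"

definition tree_less :: "('a \<Rightarrow> 'a \<Rightarrow> bool) \<Rightarrow> 'a \<Rightarrow> 'a \<Rightarrow> 'a \<Rightarrow> bool" where
  "tree_less E r t s \<longleftrightarrow> tree_le E r t s \<and> t \<noteq> s"

definition tree_order :: "('a \<Rightarrow> 'a \<Rightarrow> bool) \<Rightarrow> 'a \<Rightarrow> 'a \<Rightarrow> nat" where
  "tree_order E r t = card {v. tree_less E r v t}"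

text \<open>
  The definition is inhabited by the standard model: finite binary words, the two
  offspring of a word being its one-letter extensions, with the prefix order.
\<close>

lemma path_to_words:
  "path_to (\<lambda>u v. \<exists>b. v = u @ [b]) [] t p \<longleftrightarrow> p = prefixes (t :: 'b list)"
proof (induction t arbitrary: p rule: rev_induct)
  case Nil
  show ?case
  proof
    assume p: "path_to (\<lambda>u v. \<exists>b. v = u @ [b]) [] ([] :: 'b list) p"
    show "p = prefixes []"
    proof (cases p rule: rev_cases)
      case (snoc q x)
      then show ?thesis using p
        by (cases q rule: rev_cases) (auto simp: path_to_def successively_append_iff)
    qed (use p in \<open>simp add: path_to_def\<close>)
  qed (simp add: path_to_def)
next
  case (snoc b t)
  have "path_to (\<lambda>u v. \<exists>b. v = u @ [b]) [] (t @ [b]) p \<longleftrightarrow>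
    (\<exists>q. p = q @ [t @ [b]] \<and> path_to (\<lambda>u v. \<exists>b. v = u @ [b]) [] t q)"
  proof (cases p rule: rev_cases)
    case Nil
    then show ?thesis by (simp add: path_to_def)
  next
    case (snoc q x)
    then show ?thesis
      by (cases "q = []") (auto simp: path_to_def successively_append_iff)
  qed
  with snoc show ?case by (simp add: prefixes_snoc)
qed

lemma infinite_binary_tree_words:
  "infinite_binary_tree (\<lambda>u v. \<exists>b::bool. v = u @ [b]) []"
proof -
  have "{s. \<exists>b::bool. s = t @ [b]} = {t @ [False], t @ [True]}" for t
    by (auto simp: ex_bool_eq)
  then show ?thesis
    by (simp add: infinite_binary_tree_def rooted_tree_def path_to_words)
qed

lemma tree_le_words:
  "tree_le (\<lambda>u v. \<exists>b::bool. v = u @ [b]) [] t s \<longleftrightarrow> prefix t s"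
  by (simp add: tree_le_def path_to_words)

text \<open>
  The real sequence spaces over the index type \<open>'a\<close>, for \<open>1 \<le> p < \<infinity>\<close>; \<open>lp_norm p\<close> is
  meaningful only on \<open>lp_space p\<close>, since \<open>infsum\<close> of a non-summable family is \<open>0\<close>.
\<close>

definition lp_space :: "real \<Rightarrow> ('a \<Rightarrow> real) set" where
  "lp_space p = {f. (\<lambda>t. \<bar>f t\<bar> powr p) summable_on UNIV}"

definition lp_norm :: "real \<Rightarrow> ('a \<Rightarrow> real) \<Rightarrow> real" where
  "lp_norm p f = (\<Sum>\<^sub>\<infinity>t. \<bar>f t\<bar> powr p) powr (1 / p)"

definition weighted_summation ::
  "('a \<Rightarrow> 'a \<Rightarrow> bool) \<Rightarrow> 'a \<Rightarrow> ('a \<Rightarrow> real) \<Rightarrow> ('a \<Rightarrow> real) \<Rightarrow> ('a \<Rightarrow> real) \<Rightarrow> 'a \<Rightarrow> real" where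
  "weighted_summation E r \<alpha> \<sigma> \<mu> t = \<alpha> t * (\<Sum>\<^sub>\<infinity>s\<in>{s. tree_le E r t s}. \<sigma> s * \<mu> s)"

text \<open>
  Dyadic entropy numbers of \<open>V : X \<rightarrow> Y\<close>, where the normed spaces are given by carriers \<open>X\<close>, \<open>Y\<close>
  and norms \<open>NX\<close>, \<open>NY\<close>. The infimum is taken in the extended reals, so that it is \<open>\<infinity>\<close>
  when no \<open>\<epsilon>\<close> is admissible; as the balls are subsets of \<open>Y\<close>, a finite value implies that \<open>V\<close>
  maps the unit ball of \<open>X\<close> into a bounded subset of \<open>Y\<close>.
\<close>

definition entropy_number ::
  "'x set \<Rightarrow> ('x \<Rightarrow> real) \<Rightarrow> ('y::ab_group_add) set \<Rightarrow> ('y \<Rightarrow> real) \<Rightarrow> ('x \<Rightarrow> 'y) \<Rightarrow> nat \<Rightarrow> ereal"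
where
  "entropy_number X NX Y NY V n =
     Inf (ereal ` {\<epsilon>. 0 < \<epsilon> \<and> (\<exists>C. C \<subseteq> Y \<and> finite C \<and> card C \<le> 2 ^ (n - 1) \<and>
       V ` {x \<in> X. NX x \<le> 1} \<subseteq> (\<Union>c\<in>C. {y \<in> Y. NY (y - c) < \<epsilon>}))})"

end

theory Submission
  imports Defs
begin

text \<open>
  Identify the tree with finite binary words. By splitting \<open>\<mu>\<close> into positive and negative parts it is
  enough to treat \<open>\<mu> \<ge> 0\<close> with total mass at most \<open>1\<close>; then the image of \<open>\<mu>\<close> at \<open>w\<close> is
  \<open>m w / (\<bar>w\<bar> + 1)\<close>, where \<open>m w\<close> is the mass of the subtree at \<open>w\<close>. Round it down to the multiple
  \<open>q w / N\<close> of \<open>1 / N\<close>, with \<open>N\<close> proportional to \<open>n\<close>.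

  Since \<open>m\<close> decreases along root paths, \<open>q\<close> is supported on a subtree. Along a path on which
  \<open>q > 0\<close> up to level \<open>K\<close>, the mass is at least \<open>(K + 1) / N\<close>, and integrating over paths yields
  \<open>\<Sum> \<surd>(q w) \<le> 2 N\<close>. Along a path on which \<open>q = 0\<close> from level \<open>k\<close> on, the mass is at most
  \<open>(k + 1) / N\<close>, and \<open>\<Sum>\<^bsub>j \<ge> k\<^esub> 1 / (j + 1)\<^sup>2 \<le> 2 / (k + 1)\<close>. No logarithm is lost in either estimate,
  and the squared rounding error is at most \<open>4 / N\<close>. Finally, weighting the labelled subtrees in the
  manner of Kraft's inequality shows that at most \<open>2 exp (14 N)\<close> functions \<open>q\<close> occur.
\<close>

subsection \<open>Subtree masses and their rounding\<close>

definition subtree_mass :: "(bool list \<Rightarrow> real) \<Rightarrow> bool list \<Rightarrow> real" where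
  "subtree_mass \<mu> w = (\<Sum>\<^sub>\<infinity>s\<in>{s. prefix w s}. \<mu> s)"

lemma summable_on_prefixes:
  fixes \<mu> :: "bool list \<Rightarrow> real"
  assumes "\<mu> summable_on UNIV"
  shows "\<mu> summable_on {s. prefix w s}"
  using summable_on_subset[OF assms] by simp

lemma subtree_mass_nonneg:
  assumes "\<And>s. 0 \<le> \<mu> s"
  shows "0 \<le> subtree_mass \<mu> w"
  unfolding subtree_mass_def by (intro infsum_nonneg assms)

lemma subtree_mass_antimono:
  assumes "\<And>s. 0 \<le> \<mu> s" "\<mu> summable_on UNIV" "prefix v w"
  shows "subtree_mass \<mu> w \<le> subtree_mass \<mu> v"
  unfolding subtree_mass_def
  by (rule infsum_mono_neutral)
    (use assms summable_on_prefixes in \<open>auto intro: prefix_order.trans\<close>)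

lemma subtree_mass_le_total:
  assumes "\<And>s. 0 \<le> \<mu> s" "\<mu> summable_on UNIV"
  shows "subtree_mass \<mu> w \<le> infsum \<mu> UNIV"
  unfolding subtree_mass_def
  by (rule infsum_mono_neutral) (use assms summable_on_prefixes in auto)

lemma has_sum_finite_sum:
  fixes f :: "'i \<Rightarrow> 'a \<Rightarrow> real"
  assumes "\<And>i. i \<in> F \<Longrightarrow> f i summable_on A"
  shows "((\<lambda>x. \<Sum>i\<in>F. f i x) has_sum (\<Sum>i\<in>F. infsum (f i) A)) A"
  using assms
proof (induction F rule: infinite_finite_induct)
  case (insert i F)
  then have "((\<lambda>x. f i x + (\<Sum>j\<in>F. f j x)) has_sum (infsum (f i) A + (\<Sum>j\<in>F. infsum (f j) A))) A"
    by (intro has_sum_add has_sum_infsum) auto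
  then show ?case using insert.hyps by simp
qed auto

text \<open>
  A sum of masses over vertices is an integral against \<open>\<mu>\<close> of sums along root paths; this reduces all
  estimates to one-dimensional sums over levels.
\<close>

lemma sum_subtree_mass_le:
  fixes c :: "bool list \<Rightarrow> real"
  assumes nonneg: "\<And>s. 0 \<le> \<mu> s" and summable: "\<mu> summable_on UNIV" and le1: "infsum \<mu> UNIV \<le> 1"
    and "finite F" and "0 \<le> b"
    and path: "\<And>s. (\<Sum>w | w \<in> F \<and> prefix w s. c w) \<le> b"
  shows "(\<Sum>w\<in>F. c w * subtree_mass \<mu> w) \<le> b"
proof -
  let ?g = "\<lambda>w s. c w * (if prefix w s then \<mu> s else 0)"
  have ind: "(\<lambda>s. if prefix w s then \<mu> s else 0) summable_on UNIV" for w
    using summable_on_prefixes[OF summable, of w]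
    by (subst summable_on_cong_neutral[where T = "{s. prefix w s}" and g = \<mu>]) auto
  have "c w * subtree_mass \<mu> w = infsum (?g w) UNIV" for w
  proof -
    have "subtree_mass \<mu> w = (\<Sum>\<^sub>\<infinity>s. if prefix w s then \<mu> s else 0)"
      unfolding subtree_mass_def by (rule infsum_cong_neutral) auto
    then show ?thesis by (simp only: infsum_cmult_right[OF ind])
  qed
  then have "(\<Sum>w\<in>F. c w * subtree_mass \<mu> w) = (\<Sum>w\<in>F. infsum (?g w) UNIV)"
    by simp
  also have "\<dots> = (\<Sum>\<^sub>\<infinity>s. \<Sum>w\<in>F. ?g w s)"
    by (intro infsumI[symmetric] has_sum_finite_sum summable_on_cmult_right ind)
  also have "\<dots> \<le> (\<Sum>\<^sub>\<infinity>s. b * \<mu> s)"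
  proof (rule infsum_mono)
    show "(\<lambda>s. \<Sum>w\<in>F. ?g w s) summable_on UNIV"
      by (intro has_sum_imp_summable[OF has_sum_finite_sum] summable_on_cmult_right ind)
    show "(\<lambda>s. b * \<mu> s) summable_on UNIV"
      by (intro summable_on_cmult_right summable)
    show "(\<Sum>w\<in>F. ?g w s) \<le> b * \<mu> s" for s
    proof -
      have "(\<Sum>w\<in>F. ?g w s) = (\<Sum>w | w \<in> F \<and> prefix w s. c w * \<mu> s)"
        using \<open>finite F\<close> by (intro sum.mono_neutral_cong_right) auto
      also have "\<dots> = (\<Sum>w | w \<in> F \<and> prefix w s. c w) * \<mu> s"
        by (simp add: sum_distrib_right)
      also have "\<dots> \<le> b * \<mu> s" by (intro mult_right_mono path nonneg)
      finally show ?thesis .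
    qed
  qed
  also have "\<dots> = b * infsum \<mu> UNIV"
    using infsum_cmult_right[of b \<mu> UNIV] summable by auto
  also have "\<dots> \<le> b"
    using mult_left_mono[OF le1 \<open>0 \<le> b\<close>] by simp
  finally show ?thesis .
qed

section \<open>Sums over the levels of one root path, which meets each level at most once\<close>

lemma inj_on_length_prefixes: "inj_on length {w. prefix w s}"
  by (auto simp: inj_on_def) (metis prefix_length_prefix prefix_order.antisym le_refl)

lemma sum_inverse_sqrt_le: "(\<Sum>k\<le>K. 1 / sqrt (real k + 1)) \<le> 2 * sqrt (real K + 1)"
proof (induction K)
  case (Suc K)
  have "1 / sqrt (real (Suc K) + 1) \<le> 2 * (sqrt (real (Suc K) + 1) - sqrt (real K + 1))"
  proof -
    define a b where "a = sqrt (real (Suc K) + 1)" and "b = sqrt (real K + 1)"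
    have "0 < a" "0 < b" "b \<le> a" "a\<^sup>2 - b\<^sup>2 = 1"
      by (auto simp: a_def b_def)
    moreover have "a * a - b * b = 1" using \<open>a\<^sup>2 - b\<^sup>2 = 1\<close> by (simp add: power2_eq_square)
    moreover have "(a - b)^2 \<ge> 0" by simp
    \<comment> \<open>After multiplication by \<open>a\<close>, the gap is
      \<open>2 * a * (a - b) - (a * a - b * b)\<close>, which is the square of
      \<open>a - b\<close>.\<close>
    ultimately have "1 / a \<le> 2 * (a - b)"
      by (simp add: field_simps power2_eq_square)
    then show ?thesis by (simp add: a_def b_def)
  qed
  then show ?case using Suc by simp
qed simp

text \<open>The subtracted \<open>1 / (K + 1)\<close> makes the induction close: each new term is at
  most the telescoping difference \<open>1 / (K + 1) - 1 / (K + 2)\<close>.\<close>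

lemma sum_inverse_square_le:
  "k \<le> K \<Longrightarrow> (\<Sum>j=k..K. 1 / (real j + 1)\<^sup>2) \<le> 2 / (real k + 1) - 1 / (real K + 1)"
proof (induction K rule: dec_induct)
  case base
  have "1 / (real k + 1)\<^sup>2 \<le> 1 / (real k + 1)"
    by (rule frac_le) (use self_le_power[of "real k + 1" 2] in auto)
  then show ?case by simp
next
  case (step K)
  have "1 / (real (Suc K) + 1)\<^sup>2 \<le> 1 / ((real K + 1) * (real (Suc K) + 1))"
    by (intro divide_left_mono) (auto simp: power2_eq_square)
  also have "\<dots> = 1 / (real K + 1) - 1 / (real (Suc K) + 1)"
    by (simp add: divide_simps)
  finally have "1 / (real (Suc K) + 1)\<^sup>2 \<le> 1 / (real K + 1) - 1 / (real (Suc K) + 1)" .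
  then show ?case using step by simp
qed

text \<open>The deepest vertex of \<open>F\<close>, at level \<open>K\<close>, has mass at least
  \<open>(K + 1) / N\<close>, and so have all the others, being its prefixes. This bounds the sum by
  \<open>N / sqrt (K + 1)\<close> times at most \<open>2 * sqrt (K + 1)\<close>. The summand times
  the mass is the root of \<open>N * subtree_mass \<mu> w / (length w + 1)\<close>, the number to be
  rounded.\<close>

lemma sum_heavy_path_le:
  assumes "\<And>s. 0 \<le> \<mu> s" "\<mu> summable_on UNIV" "0 < N" "finite F"
    and F: "\<And>w. w \<in> F \<Longrightarrow> prefix w s \<and> (real (length w) + 1) / N \<le> subtree_mass \<mu> w"
  shows "(\<Sum>w\<in>F. sqrt (N / (subtree_mass \<mu> w * (real (length w) + 1)))) \<le> 2 * N"
proof (cases "F = {}")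
  case True
  then show ?thesis using \<open>0 < N\<close> by simp
next
  case False
  define K where "K = Max (length ` F)"
  have "K \<in> length ` F" unfolding K_def using False \<open>finite F\<close> by simp
  then obtain v where v: "v \<in> F" "length v = K" by auto
  have len: "length w \<le> K" if "w \<in> F" for w
    unfolding K_def using that \<open>finite F\<close> by simp
  have "sqrt (N / (subtree_mass \<mu> w * (real (length w) + 1)))
      \<le> N / sqrt (real K + 1) * (1 / sqrt (real (length w) + 1))" if "w \<in> F" for w
  proof -
    have "prefix w v"
      using F[OF that] F[OF v(1)] len[OF that] v(2) prefix_length_prefix by blast
    then have "subtree_mass \<mu> v \<le> subtree_mass \<mu> w"
      using subtree_mass_antimono assms by blast
    then have "(real K + 1) / N \<le> subtree_mass \<mu> w" using F[OF v(1)] unfolding v(2) by linarith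
    moreover have "0 < (real K + 1) / N" using \<open>0 < N\<close> by simp
    moreover from calculation have "0 < subtree_mass \<mu> w" by linarith
    ultimately have "N / (subtree_mass \<mu> w * (real (length w) + 1))
        \<le> N / ((real K + 1) / N * (real (length w) + 1))"
      using \<open>0 < N\<close> by (intro divide_left_mono mult_right_mono mult_pos_pos) auto
    then have "sqrt (N / (subtree_mass \<mu> w * (real (length w) + 1)))
        \<le> sqrt (N * N / ((real K + 1) * (real (length w) + 1)))"
      using \<open>0 < N\<close> by simp
    also have "\<dots> = N / sqrt (real K + 1) * (1 / sqrt (real (length w) + 1))"
      using \<open>0 < N\<close> by (simp add: real_sqrt_divide real_sqrt_mult)
    finally show ?thesis .
  qed
  then have "(\<Sum>w\<in>F. sqrt (N / (subtree_mass \<mu> w * (real (length w) + 1))))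
      \<le> (\<Sum>w\<in>F. N / sqrt (real K + 1) * (1 / sqrt (real (length w) + 1)))"
    by (rule sum_mono)
  also have "\<dots> = N / sqrt (real K + 1) * (\<Sum>k\<in>length ` F. 1 / sqrt (real k + 1))"
    using F by (subst sum.reindex)
      (auto intro!: inj_on_subset[OF inj_on_length_prefixes[of s]] simp: sum_distrib_left)
  also have "\<dots> \<le> N / sqrt (real K + 1) * (\<Sum>k\<le>K. 1 / sqrt (real k + 1))"
    using \<open>0 < N\<close> len by (intro mult_left_mono sum_mono2) auto
  also have "\<dots> \<le> N / sqrt (real K + 1) * (2 * sqrt (real K + 1))"
    using \<open>0 < N\<close> by (intro mult_left_mono sum_inverse_sqrt_le) auto
  also have "\<dots> = 2 * N" by (simp add: add_nonneg_eq_0_iff)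
  finally show ?thesis .
qed

text \<open>Here the shallowest vertex decides: its mass, at most \<open>(k + 1) / N\<close>, bounds
  all masses below it, and the factor \<open>k + 1\<close> cancels against the tail of the inverse
  squares. Multiplied by the mass once more, the summand is the squared error at a vertex with label
  0.\<close>

lemma sum_light_path_le:
  assumes "\<And>s. 0 \<le> \<mu> s" "\<mu> summable_on UNIV" "0 < N" "finite F"
    and F: "\<And>w. w \<in> F \<Longrightarrow> prefix w s \<and> subtree_mass \<mu> w \<le> (real (length w) + 1) / N"
  shows "(\<Sum>w\<in>F. subtree_mass \<mu> w / (real (length w) + 1)\<^sup>2) \<le> 2 / N"
proof (cases "F = {}")
  case True
  then show ?thesis using \<open>0 < N\<close> by simp
next
  case False
  define k where "k = Min (length ` F)"
  define K where "K = Max (length ` F)"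
  have "k \<in> length ` F" unfolding k_def using False \<open>finite F\<close> by simp
  then obtain v where v: "v \<in> F" "length v = k" by auto
  have len: "length w \<le> K" "k \<le> length w" if "w \<in> F" for w
    unfolding K_def k_def using that \<open>finite F\<close> by simp_all
  have "subtree_mass \<mu> w / (real (length w) + 1)\<^sup>2
      \<le> (real k + 1) / N * (1 / (real (length w) + 1)\<^sup>2)" if "w \<in> F" for w
  proof -
    have "prefix v w"
      using F[OF that] F[OF v(1)] len[OF that] v(2) prefix_length_prefix by blast
    then have "subtree_mass \<mu> w \<le> subtree_mass \<mu> v"
      using subtree_mass_antimono assms by blast
    then have "subtree_mass \<mu> w \<le> (real k + 1) / N" using F[OF v(1)] unfolding v(2) by linarith
    from divide_right_mono[OF this, of "(real (length w) + 1)\<^sup>2"] show ?thesis by simp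
  qed
  then have "(\<Sum>w\<in>F. subtree_mass \<mu> w / (real (length w) + 1)\<^sup>2)
      \<le> (\<Sum>w\<in>F. (real k + 1) / N * (1 / (real (length w) + 1)\<^sup>2))"
    by (rule sum_mono)
  also have "\<dots> = (real k + 1) / N * (\<Sum>j\<in>length ` F. 1 / (real j + 1)\<^sup>2)"
    using F by (subst sum.reindex)
      (auto intro!: inj_on_subset[OF inj_on_length_prefixes[of s]] simp: sum_distrib_left)
  also have "\<dots> \<le> (real k + 1) / N * (\<Sum>j=k..K. 1 / (real j + 1)\<^sup>2)"
    using \<open>0 < N\<close> len by (intro mult_left_mono sum_mono2) auto
  also have "\<dots> \<le> (real k + 1) / N * (2 / (real k + 1))"
  proof -
    have "k \<le> K" using len v(1) by fastforce
    from sum_inverse_square_le[OF this] have "(\<Sum>j=k..K. 1 / (real j + 1)\<^sup>2) \<le> 2 / (real k + 1)"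
      by (smt (verit) of_nat_0_le_iff zero_le_divide_1_iff)
    then show ?thesis using \<open>0 < N\<close> by (intro mult_left_mono) auto
  qed
  also have "\<dots> = 2 / N"
  proof -
    have "x / N * (2 / x) = 2 / N" if "x \<noteq> 0" for x :: real using that by simp
    from this[of "real k + 1"] show ?thesis by linarith
  qed
  finally show ?thesis .
qed

section \<open>Size and error of the rounded masses\<close>

definition profile :: "real \<Rightarrow> (bool list \<Rightarrow> real) \<Rightarrow> bool list \<Rightarrow> nat" where
  "profile N \<mu> w = nat \<lfloor>N * subtree_mass \<mu> w / (real (length w) + 1)\<rfloor>"

lemma profile_pos_iff:
  assumes "0 < N"
  shows "0 < profile N \<mu> w \<longleftrightarrow> (real (length w) + 1) / N \<le> subtree_mass \<mu> w"
  using assms by (auto simp: profile_def field_simps)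

lemma profile_antimono:
  assumes "\<And>s. 0 \<le> \<mu> s" "\<mu> summable_on UNIV" "0 < N" "prefix v w"
  shows "profile N \<mu> w \<le> profile N \<mu> v"
proof -
  have "N * subtree_mass \<mu> w / (real (length w) + 1) \<le> N * subtree_mass \<mu> v / (real (length v) + 1)"
    using subtree_mass_antimono[OF assms(1,2,4)] subtree_mass_nonneg[OF assms(1)] prefix_length_le[OF assms(4)] \<open>0 < N\<close>
    by (intro frac_le mult_left_mono mult_nonneg_nonneg) auto
  then show ?thesis unfolding profile_def by (intro nat_mono floor_mono)
qed

text \<open>The root is not linear in the mass, so it is bounded by the mass times a coefficient
  that itself depends on the mass. By \<open>sum_heavy_path_le\<close> these coefficients sum to at
  most \<open>2 * N\<close> along every root path, and integrating against \<mu> keeps the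
  bound.\<close>

lemma sum_sqrt_profile_le:
  assumes "\<And>s. 0 \<le> \<mu> s" "\<mu> summable_on UNIV" "infsum \<mu> UNIV \<le> 1" "0 < N"
    and "finite F" and F: "\<And>w. w \<in> F \<Longrightarrow> 0 < profile N \<mu> w"
  shows "(\<Sum>w\<in>F. sqrt (real (profile N \<mu> w))) \<le> 2 * N"
proof -
  let ?m = "subtree_mass \<mu>"
  have heavy: "(real (length w) + 1) / N \<le> ?m w" if "w \<in> F" for w
    using F[OF that] profile_pos_iff[OF \<open>0 < N\<close>] by blast
  have "sqrt (real (profile N \<mu> w)) \<le> sqrt (N / (?m w * (real (length w) + 1))) * ?m w"
    if "w \<in> F" for w
  proof -
    have "0 < (real (length w) + 1) / N" using \<open>0 < N\<close> by simp
    then have m: "0 < ?m w" using heavy[OF that] by linarith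
    have "real (profile N \<mu> w) \<le> N * ?m w / (real (length w) + 1)"
      unfolding profile_def using m \<open>0 < N\<close> by (intro of_nat_floor) simp
    also have "\<dots> = N / (?m w * (real (length w) + 1)) * (?m w)\<^sup>2"
      using m by (simp add: power2_eq_square)
    finally have "sqrt (real (profile N \<mu> w)) \<le> sqrt (N / (?m w * (real (length w) + 1)) * (?m w)\<^sup>2)"
      by simp
    also have "\<dots> = sqrt (N / (?m w * (real (length w) + 1))) * ?m w"
      using m by (simp only: real_sqrt_mult real_sqrt_pow2 real_sqrt_abs abs_of_pos)
    finally show ?thesis .
  qed
  then have "(\<Sum>w\<in>F. sqrt (real (profile N \<mu> w)))
      \<le> (\<Sum>w\<in>F. sqrt (N / (?m w * (real (length w) + 1))) * ?m w)"
    by (rule sum_mono)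
  also have "\<dots> \<le> 2 * N"
    using assms(1-5) heavy
    by (intro sum_subtree_mass_le sum_heavy_path_le) auto
  finally show ?thesis .
qed

text \<open>A positive label is at least 1, and so is its root; hence the sum of the roots bounds
  the number of vertices in any finite part of the support, which forces finiteness as well.\<close>

lemma finite_profile_support:
  assumes "\<And>s. 0 \<le> \<mu> s" "\<mu> summable_on UNIV" "infsum \<mu> UNIV \<le> 1" "0 < N"
  shows "finite {w. 0 < profile N \<mu> w} \<and> real (card {w. 0 < profile N \<mu> w}) \<le> 2 * N"
proof -
  have card: "real (card F) \<le> 2 * N" if "finite F" "F \<subseteq> {w. 0 < profile N \<mu> w}" for F
  proof -
    have "real (card F) = (\<Sum>w\<in>F. 1)" by simp
    also have "\<dots> \<le> (\<Sum>w\<in>F. sqrt (real (profile N \<mu> w)))"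
      using that by (intro sum_mono) (auto simp: subset_iff Suc_le_eq)
    also have "\<dots> \<le> 2 * N" using assms that by (intro sum_sqrt_profile_le) auto
    finally show ?thesis .
  qed
  moreover have "finite {w. 0 < profile N \<mu> w}"
  proof (rule ccontr)
    assume "infinite {w. 0 < profile N \<mu> w}"
    then obtain F where F: "finite F" "card F = Suc (nat \<lceil>2 * N\<rceil>)" "F \<subseteq> {w. 0 < profile N \<mu> w}"
      using infinite_arbitrarily_large by metis
    with card[of F] show False by linarith
  qed
  ultimately show ?thesis by blast
qed

text \<open>At most \<open>2 * N\<close> vertices have a positive label, each with squared error at
  most \<open>1 / N^2\<close>. At label 0 the error is the whole value; its square is a coefficient
  times the mass, and \<open>sum_light_path_le\<close> controls the coefficients along root paths.
  Each group contributes at most \<open>2 / N\<close>.\<close>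

lemma sum_profile_error_le:
  assumes "\<And>s. 0 \<le> \<mu> s" "\<mu> summable_on UNIV" "infsum \<mu> UNIV \<le> 1" "0 < N" "finite F"
  shows "(\<Sum>w\<in>F. (subtree_mass \<mu> w / (real (length w) + 1) - real (profile N \<mu> w) / N)\<^sup>2) \<le> 4 / N"
proof -
  let ?m = "subtree_mass \<mu>" and ?q = "profile N \<mu>"
  let ?e = "\<lambda>w. (?m w / (real (length w) + 1) - real (?q w) / N)\<^sup>2"
  let ?H = "{w \<in> F. 0 < ?q w}" and ?L = "{w \<in> F. ?q w = 0}"
  have "sum ?e ?H \<le> (\<Sum>w\<in>?H. 1 / N\<^sup>2)"
  proof (rule sum_mono)
    fix w
    let ?x = "N * ?m w / (real (length w) + 1)"
    have x: "0 \<le> ?x" using subtree_mass_nonneg[OF assms(1)] \<open>0 < N\<close> by simp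
    then have "real (?q w) \<le> ?x" "?x < real (?q w) + 1"
      unfolding profile_def by linarith+
    then have "(?x - real (?q w))\<^sup>2 \<le> 1\<^sup>2" by (intro power_mono) auto
    moreover have "?m w / (real (length w) + 1) - real (?q w) / N = (?x - real (?q w)) / N"
      using \<open>0 < N\<close> by (simp add: diff_divide_distrib)
    ultimately show "?e w \<le> 1 / N\<^sup>2"
      by (simp add: power_divide divide_right_mono)
  qed
  also have "\<dots> = real (card ?H) / N\<^sup>2" by simp
  also have "\<dots> \<le> 2 * N / N\<^sup>2"
  proof (rule divide_right_mono)
    have "card ?H \<le> card {w. 0 < ?q w}"
      using finite_profile_support[OF assms(1-4)] by (intro card_mono) auto
    then show "real (card ?H) \<le> 2 * N" using finite_profile_support[OF assms(1-4)] by linarith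
  qed simp
  finally have H: "sum ?e ?H \<le> 2 / N" using \<open>0 < N\<close> by (simp add: power2_eq_square)
  have "sum ?e ?L = (\<Sum>w\<in>?L. ?m w / (real (length w) + 1)\<^sup>2 * ?m w)"
    by (intro sum.cong) (auto simp: power2_eq_square)
  also have "\<dots> \<le> 2 / N"
  proof (intro sum_subtree_mass_le sum_light_path_le assms(1-4))
    fix s w assume "w \<in> {w \<in> ?L. prefix w s}"
    moreover from this have "\<not> 0 < ?q w" by simp
    ultimately show "prefix w s \<and> ?m w \<le> (real (length w) + 1) / N"
      unfolding profile_pos_iff[OF \<open>0 < N\<close>] by simp
  qed (use assms in auto)
  finally have "sum ?e ?L \<le> 2 / N" .
  moreover have "sum ?e F = sum ?e ?H + sum ?e ?L"
    using \<open>finite F\<close> by (subst sum.union_disjoint[symmetric]) (auto intro: sum.cong)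
  ultimately show ?thesis using H by simp
qed

subsection \<open>Counting the rounded profiles\<close>

text \<open>
  A Kraft-type weight: the label weights sum to at most \<open>1/4\<close>, which makes \<open>2\<close> a fixed bound of the
  recursion \<open>Z \<mapsto> 1 + Z\<^sup>2 / 4\<close> for the total weight over the two subtrees.
\<close>

definition code_weight :: "(bool list \<Rightarrow> nat) \<Rightarrow> real" where
  "code_weight q = (\<Prod>w | 0 < q w. 1 / (4 * real (q w) * (real (q w) + 1)))"

text \<open>The depth bound serves induction: passing to a subtree below the root lowers it by one.
  Monotonicity makes the support a rooted subtree, so that label 0 at the root leaves only the zero
  labelling.\<close>

definition decreasing_labellings :: "nat \<Rightarrow> (bool list \<Rightarrow> nat) set" where
  "decreasing_labellings d =
    {q. (\<forall>w. 0 < q w \<longrightarrow> length w < d) \<and> (\<forall>v w. prefix v w \<longrightarrow> q w \<le> q v)}"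

lemma code_weight_nonneg: "0 \<le> code_weight q"
  unfolding code_weight_def by (intro prod_nonneg) simp

lemma finite_support_decreasing_labellings:
  assumes "q \<in> decreasing_labellings d"
  shows "finite {w. 0 < q w}"
proof (rule finite_subset)
  show "{w. 0 < q w} \<subseteq> {w. set w \<subseteq> UNIV \<and> length w \<le> d}"
    using assms by (auto simp: decreasing_labellings_def less_imp_le)
qed (rule finite_lists_length_le, simp)

lemma subtree_decreasing_labellings:
  assumes "q \<in> decreasing_labellings (Suc d)"
  shows "(\<lambda>w. q (b # w)) \<in> decreasing_labellings d"
proof -
  have "length (b # w) < Suc d" if "0 < q (b # w)" for w
    using assms that unfolding decreasing_labellings_def by blast
  moreover have "q (b # w) \<le> q (b # v)" if "prefix v w" for v w
    using assms that unfolding decreasing_labellings_def by simp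
  ultimately show ?thesis unfolding decreasing_labellings_def by simp
qed

text \<open>The support consists of the root and the supports in its two subtrees, and the product
  splits accordingly.\<close>

lemma code_weight_rec:
  assumes q: "q \<in> decreasing_labellings (Suc d)" and "0 < q []"
  shows "code_weight q = 1 / (4 * real (q []) * (real (q []) + 1)) *
    (code_weight (\<lambda>w. q (False # w)) * code_weight (\<lambda>w. q (True # w)))"
proof -
  let ?S = "\<lambda>b. {w. 0 < q (b # w)}" and ?v = "\<lambda>j. 1 / (4 * real j * (real j + 1))"
  have fin: "finite (?S b)" for b
    using finite_support_decreasing_labellings[OF subtree_decreasing_labellings[OF q]] .
  have part: "(\<Prod>w\<in>(#) b ` ?S b. ?v (q w)) = code_weight (\<lambda>w. q (b # w))" for b
    unfolding code_weight_def by (subst prod.reindex) auto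
  have "{w. 0 < q w} = insert [] ((#) False ` ?S False \<union> (#) True ` ?S True)"
  proof (intro set_eqI)
    fix w show "w \<in> {w. 0 < q w} \<longleftrightarrow> w \<in> insert [] ((#) False ` ?S False \<union> (#) True ` ?S True)"
    proof (cases w)
      case (Cons b u)
      then show ?thesis by (cases b) auto
    qed (use \<open>0 < q []\<close> in simp)
  qed
  then have "code_weight q = ?v (q []) * (\<Prod>w\<in>(#) False ` ?S False \<union> (#) True ` ?S True. ?v (q w))"
    unfolding code_weight_def using fin by (subst prod.insert[symmetric]) auto
  also have "\<dots> = ?v (q []) * ((\<Prod>w\<in>(#) False ` ?S False. ?v (q w)) * (\<Prod>w\<in>(#) True ` ?S True. ?v (q w)))"
    using fin by (subst prod.union_disjoint) auto
  finally show ?thesis unfolding part .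
qed

text \<open>The terms \<open>1 / (j * (j + 1))\<close> telescope to a total of at most 1.\<close>

lemma sum_label_weight_le:
  assumes "finite J" "0 \<notin> J"
  shows "(\<Sum>j\<in>J. 1 / (4 * real j * (real j + 1))) \<le> 1 / 4"
proof -
  have tele: "(\<Sum>j=1..M. 1 / (4 * real j * (real j + 1))) = (1 - 1 / (real M + 1)) / 4" for M :: nat
  proof (induction M)
    case (Suc M)
    have "1 / (4 * (x + 1) * (x + 1 + 1)) = (1 / (x + 1) - 1 / (x + 1 + 1)) / 4" if "0 \<le> x" for x :: real
      using that by (simp add: divide_simps)
    from this[of "real M"] show ?case using Suc by (simp add: add.commute)
  qed simp
  \<comment> \<open>The inserted 1 keeps the maximum meaningful for empty \<open>J\<close>.\<close>
  define M where "M = Max (insert 1 J)"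
  have "J \<subseteq> {1..M}"
  proof
    fix j assume "j \<in> J"
    then have "j \<noteq> 0" using assms by metis
    moreover have "j \<le> M" unfolding M_def using \<open>j \<in> J\<close> assms by simp
    ultimately show "j \<in> {1..M}" by simp
  qed
  then have "(\<Sum>j\<in>J. 1 / (4 * real j * (real j + 1))) \<le> (\<Sum>j=1..M. 1 / (4 * real j * (real j + 1)))"
    by (intro sum_mono2) auto
  also have "\<dots> \<le> 1 / 4" unfolding tele by simp
  finally show ?thesis .
qed

text \<open>Induction on the depth. Root label 0 leaves only the zero labelling, whose weight is the
  empty product 1. Any other labelling is determined by its root label and two labelled subtrees,
  and together these contribute at most \<open>1 / 4 * (2 * 2) = 1\<close>. As labels are unbounded,
  the sum is taken over finite \<open>A\<close>.\<close>

lemma sum_code_weight_le: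
  assumes "finite A" "A \<subseteq> decreasing_labellings d"
  shows "(\<Sum>q\<in>A. code_weight q) \<le> 2"
  using assms
proof (induction d arbitrary: A)
  case 0
  then have "A \<subseteq> {\<lambda>_. 0}" by (auto simp: decreasing_labellings_def fun_eq_iff)
  then have "(\<Sum>q\<in>A. code_weight q) \<le> (\<Sum>q\<in>{\<lambda>_. 0}. code_weight q)"
    by (intro sum_mono2 code_weight_nonneg) auto
  then show ?case by (simp add: code_weight_def)
next
  case (Suc d)
  let ?v = "\<lambda>j. 1 / (4 * real j * (real j + 1))"
  define ch where "ch = (\<lambda>b (q :: bool list \<Rightarrow> nat) w. q (b # w))"
  define Z where "Z = {q \<in> A. q [] = 0}"
  define P where "P = {q \<in> A. 0 < q []}"
  have fin: "finite Z" "finite P" and A: "A = Z \<union> P" and disj: "Z \<inter> P = {}"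
    using \<open>finite A\<close> by (auto simp: Z_def P_def)
  have "q = (\<lambda>_. 0)" if "q \<in> Z" for q
  proof -
    have "q \<in> decreasing_labellings (Suc d)" "q [] = 0"
      using that Suc.prems(2) by (auto simp: Z_def)
    then have "q w \<le> q []" for w
      unfolding decreasing_labellings_def using Nil_prefix by blast
    then have "q w = 0" for w using \<open>q [] = 0\<close> by (metis le_zero_eq)
    then show ?thesis by auto
  qed
  then have "(\<Sum>q\<in>Z. code_weight q) \<le> (\<Sum>q\<in>{\<lambda>_. 0}. code_weight q)"
    by (intro sum_mono2 code_weight_nonneg) auto
  then have Z: "(\<Sum>q\<in>Z. code_weight q) \<le> 1" by (simp add: code_weight_def)
  define f where "f = (\<lambda>q :: bool list \<Rightarrow> nat. (q [], ch False q, ch True q))"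
  define g where "g = (\<lambda>(j, q0, q1). ?v j * (code_weight q0 * code_weight q1))"
  let ?J = "(\<lambda>q. q []) ` P"
  have ch: "(\<Sum>q\<in>ch b ` P. code_weight q) \<le> 2" for b
    using Suc.IH[of "ch b ` P"] Suc.prems(2) fin subtree_decreasing_labellings
    by (auto simp: P_def ch_def)
  have "inj f"
  proof (rule injI, rule ext)
    fix p q w assume "f p = f q"
    then have "p [] = q []" "\<And>u. p (False # u) = q (False # u)" "\<And>u. p (True # u) = q (True # u)"
      by (auto simp: f_def ch_def fun_eq_iff)
    then show "p w = q w" by (cases w; cases "hd w") auto
  qed
  have "(\<Sum>q\<in>P. code_weight q) = (\<Sum>q\<in>P. g (f q))"
    using Suc.prems(2) by (intro sum.cong) (auto simp: P_def g_def f_def ch_def code_weight_rec)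
  also have "\<dots> = (\<Sum>x\<in>f ` P. g x)"
    by (subst sum.reindex) (use \<open>inj f\<close> in \<open>auto intro: inj_on_subset\<close>)
  \<comment> \<open>Not every triple need come from a labelling in \<open>P\<close>; since
    \<open>g\<close> is nonnegative there, passing to the full product is allowed, and then the sum
    factors.\<close>
  also have "\<dots> \<le> (\<Sum>x\<in>?J \<times> ch False ` P \<times> ch True ` P. g x)"
    using fin by (intro sum_mono2) (auto simp: f_def g_def code_weight_nonneg)
  also have "\<dots> = (\<Sum>j\<in>?J. ?v j) * ((\<Sum>q\<in>ch False ` P. code_weight q) * (\<Sum>q\<in>ch True ` P. code_weight q))"
    unfolding g_def by (simp only: sum_product sum.cartesian_product case_prod_beta) (simp add: case_prod_beta)
  also have "\<dots> \<le> 1 / 4 * (2 * 2)"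
    using fin by (intro mult_mono ch sum_label_weight_le mult_nonneg_nonneg sum_nonneg code_weight_nonneg)
      (auto simp: P_def)
  finally have "(\<Sum>q\<in>P. code_weight q) \<le> 1" by simp
  then show ?case using Z fin disj unfolding A by (simp add: sum.union_disjoint)
qed

text \<open>Compares the weight of a label with its root, the quantity bounded by
  \<open>sum_sqrt_profile_le\<close>. With \<open>s = sqrt j \<ge> 1\<close>, the denominator is at
  most \<open>8 * s ^ 4 \<le> exp (3 + 4 * s) \<le> exp (7 * s)\<close>.\<close>

lemma exp_le_label_weight:
  assumes "0 < j"
  shows "exp (- (7 * sqrt (real j))) \<le> 1 / (4 * real j * (real j + 1))"
proof -
  define s where "s = sqrt (real j)"
  have s: "1 \<le> s" "s\<^sup>2 = real j" using assms by (auto simp: s_def)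
  have "4 * real j * (real j + 1) \<le> 8 * (s\<^sup>2)\<^sup>2"
    using assms unfolding s(2) by (simp add: power2_eq_square algebra_simps)
  also have "\<dots> = 2 ^ 3 * s ^ 4" by simp
  also have "\<dots> \<le> exp 1 ^ 3 * exp s ^ 4"
  proof -
    have "2 \<le> exp (1 :: real)" "s \<le> exp s"
      using exp_ge_add_one_self[of 1] exp_ge_add_one_self[of s] by linarith+
    then show ?thesis using s by (intro mult_mono power_mono) auto
  qed
  also have "\<dots> = exp (3 + 4 * s)" by (simp add: exp_add exp_of_nat_mult[symmetric])
  also have "\<dots> \<le> exp (7 * s)" using s by simp
  finally have "1 / exp (7 * s) \<le> 1 / (4 * real j * (real j + 1))"
    using assms by (intro divide_left_mono) auto
  then show ?thesis by (simp add: s_def exp_minus field_simps)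
qed

section \<open>The number of rounded profiles\<close>

definition profiles :: "real \<Rightarrow> (bool list \<Rightarrow> nat) set" where
  "profiles N = {profile N \<mu> | \<mu>. (\<forall>s. 0 \<le> \<mu> s) \<and> \<mu> summable_on UNIV \<and> infsum \<mu> UNIV \<le> 1}"

text \<open>Each factor of the code weight is at least \<open>exp (- 7 * sqrt (q w))\<close>, and
  the roots sum to at most \<open>2 * N\<close>; hence the exponent 14.\<close>

lemma profilesE:
  assumes "q \<in> profiles N" "0 < N"
  obtains d where "q \<in> decreasing_labellings d" "exp (- (14 * N)) \<le> code_weight q"
proof -
  obtain \<mu> where q: "q = profile N \<mu>" and \<mu>: "\<And>s. 0 \<le> \<mu> s" "\<mu> summable_on UNIV" "infsum \<mu> UNIV \<le> 1"
    using assms(1) by (auto simp: profiles_def)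
  have fin: "finite {w. 0 < q w}"
    using finite_profile_support[OF \<mu> \<open>0 < N\<close>] by (simp add: q)
  \<comment> \<open>\<open>Suc\<close> makes the depth bound strict; the inserted 0 covers the empty
    support.\<close>
  define d where "d = Suc (Max (insert 0 (length ` {w. 0 < q w})))"
  have "length w < d" if "0 < q w" for w
    unfolding d_def using that fin by (intro le_imp_less_Suc Max_ge) auto
  then have "q \<in> decreasing_labellings d"
    using profile_antimono[OF \<mu>(1,2) \<open>0 < N\<close>] by (auto simp: decreasing_labellings_def q)
  moreover have "exp (- (14 * N)) \<le> code_weight q"
  proof -
    have "(\<Sum>w | 0 < q w. sqrt (real (q w))) \<le> 2 * N"
      using sum_sqrt_profile_le[OF \<mu> \<open>0 < N\<close> fin] by (simp add: q)
    then have "exp (- (14 * N)) \<le> exp (\<Sum>w | 0 < q w. - (7 * sqrt (real (q w))))"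
      by (simp add: sum_negf sum_distrib_left[symmetric])
    also have "\<dots> = (\<Prod>w | 0 < q w. exp (- (7 * sqrt (real (q w)))))"
      using fin by (rule exp_sum)
    also have "\<dots> \<le> code_weight q"
      unfolding code_weight_def by (intro prod_mono) (auto intro: exp_le_label_weight)
    finally show ?thesis .
  qed
  ultimately show thesis by (rule that)
qed

lemma finite_support_profiles:
  assumes "q \<in> profiles N" "0 < N"
  shows "finite {w. 0 < q w}"
  using profilesE[OF assms] finite_support_decreasing_labellings by blast

text \<open>Every member weighs at least \<open>exp (- (14 * N))\<close>, while the total weight is
  at most 2. Finitely many profiles share one depth bound, so the estimate comes first for finite
  subsets; finiteness of the whole set follows from it.\<close>

lemma card_profiles_subset_le:
  assumes "0 < N" "finite A" "A \<subseteq> profiles N"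
  shows "real (card A) \<le> 2 * exp (14 * N)"
proof -
  have "\<forall>q\<in>A. \<exists>d. q \<in> decreasing_labellings d \<and> exp (- (14 * N)) \<le> code_weight q"
    using assms(1,3) profilesE by (meson subsetD)
  then obtain d where d: "\<And>q. q \<in> A \<Longrightarrow> q \<in> decreasing_labellings (d q) \<and> exp (- (14 * N)) \<le> code_weight q"
    by metis
  define D where "D = Max (insert 0 (d ` A))"
  have "decreasing_labellings (d q) \<subseteq> decreasing_labellings D" if "q \<in> A" for q
  proof -
    have "d q \<le> D" unfolding D_def using that \<open>finite A\<close> by simp
    then show ?thesis by (auto simp: decreasing_labellings_def intro: less_le_trans)
  qed
  then have "A \<subseteq> decreasing_labellings D" using d by blast
  then have "(\<Sum>q\<in>A. code_weight q) \<le> 2" by (intro sum_code_weight_le \<open>finite A\<close>)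
  moreover have "(\<Sum>q\<in>A. exp (- (14 * N))) \<le> (\<Sum>q\<in>A. code_weight q)"
    using d by (intro sum_mono) auto
  ultimately have "real (card A) * exp (- (14 * N)) \<le> 2" by simp
  then show ?thesis by (simp add: exp_minus field_simps)
qed

lemma finite_profiles:
  assumes "0 < N"
  shows "finite (profiles N)"
proof (rule ccontr)
  assume "infinite (profiles N)"
  then obtain A where A: "finite A" "card A = Suc (nat \<lceil>2 * exp (14 * N)\<rceil>)" "A \<subseteq> profiles N"
    using infinite_arbitrarily_large by metis
  with card_profiles_subset_le[OF assms A(1,3)] show False by linarith
qed

text \<open>For \<open>N < 1\<close> everything rounds to 0. This serves small \<open>n\<close>,
  where the exponential bound is too weak: for \<open>n = 1\<close> only one ball is
  allowed.\<close>

lemma card_profiles_le_1: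
  assumes "0 < N" "N < 1"
  shows "card (profiles N) \<le> 1"
proof -
  have "profile N \<mu> w = 0"
    if "\<And>s. 0 \<le> \<mu> s" "\<mu> summable_on UNIV" "infsum \<mu> UNIV \<le> 1" for \<mu> w
  proof -
    have "subtree_mass \<mu> w \<le> 1" using subtree_mass_le_total[OF that(1,2)] that(3) order_trans by blast
    then have "N * subtree_mass \<mu> w \<le> N * 1" using assms by (intro mult_left_mono) auto
    then have "N * subtree_mass \<mu> w < real (length w) + 1" using assms by linarith
    then show ?thesis by (simp add: profile_def floor_less_iff)
  qed
  then have "profiles N \<subseteq> {\<lambda>_. 0}" by (auto simp: profiles_def)
  then show ?thesis using card_mono[of "{\<lambda>_. 0}" "profiles N"] by simp
qed

text \<open>The square counts pairs of profiles, one for each sign of \<mu>. As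
  \<open>112 = 8 * 14\<close>, the squared bound is \<open>4 * exp (n / 4)\<close>, to be compared
  with \<open>4 * 2 ^ (n - 3)\<close>.\<close>

lemma card_profiles_square_le:
  assumes "1 \<le> n"
  shows "(card (profiles (real n / 112)))\<^sup>2 \<le> 2 ^ (n - 1)"
proof (cases "n < 112")
  case True
  then have "card (profiles (real n / 112)) \<le> 1"
    using assms by (intro card_profiles_le_1) auto
  then have "(card (profiles (real n / 112)))\<^sup>2 \<le> 1" using power_mono[of _ "1::nat" 2] by fastforce
  then show ?thesis using one_le_power[of "2::nat" "n - 1"] by linarith
next
  case False
  let ?N = "real n / 112"
  have "0 < ?N" using assms by simp
  have "(real (card (profiles ?N)))\<^sup>2 \<le> (2 * exp (14 * ?N))\<^sup>2"
    using card_profiles_subset_le[OF \<open>0 < ?N\<close> finite_profiles[OF \<open>0 < ?N\<close>] order_refl]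
    by (intro power_mono) auto
  also have "\<dots> = 4 * exp (real n / 4)"
    by (simp add: power_mult_distrib exp_double[symmetric])
  also have "\<dots> \<le> 4 * 2 ^ (n - 3)"
  proof -
    have "exp (1 / 2 :: real) \<le> 2"
    proof -
      have "exp (1/2 :: real) ^ 2 \<le> 2 ^ 2"
        using exp_le by (simp add: exp_double[symmetric])
      then show ?thesis by (rule power2_le_imp_le) simp
    qed
    then have "exp (1 / 2 :: real) ^ (n - 3) \<le> 2 ^ (n - 3)" by (intro power_mono) auto
    \<comment> \<open>The exponents satisfy \<open>n / 4 \<le> (n - 3) / 2\<close> as soon as
      \<open>n \<ge> 6\<close>.\<close>
    moreover have "exp (real n / 4) \<le> exp (1 / 2) ^ (n - 3)"
      using False by (simp add: exp_of_nat_mult[symmetric] of_nat_diff)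
    ultimately show ?thesis by simp
  qed
  also have "\<dots> = 2 ^ (n - 1)"
  proof -
    have "n - 1 = Suc (Suc (n - 3))" using False by simp
    then show ?thesis by simp
  qed
  finally have "real ((card (profiles ?N))\<^sup>2) \<le> real (2 ^ (n - 1))" by simp
  then show ?thesis by (simp only: of_nat_le_iff)
qed

subsection \<open>Binary trees as words\<close>

text \<open>Order the two offspring of every vertex; a word then describes a descent from the root,
  and \<open>\<phi>\<close> sends it to the endpoint. The images of its prefixes form the path to
  that endpoint, so existence of paths gives surjectivity, and their uniqueness gives injectivity
  and the order.\<close>

lemma infinite_binary_tree_words_iso:
  assumes "infinite_binary_tree E r"
  obtains \<phi> :: "bool list \<Rightarrow> 'a" where "bij \<phi>"
    "\<And>v w. tree_le E r (\<phi> v) (\<phi> w) \<longleftrightarrow> prefix v w"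
    "\<And>w. tree_order E r (\<phi> w) = length w"
proof -
  have "\<exists>a b. {s. E t s} = {a, b} \<and> a \<noteq> b" for t
    using assms by (simp add: infinite_binary_tree_def card_2_iff)
  then obtain a b where ab: "\<And>t. {s. E t s} = {a t, b t} \<and> a t \<noteq> b t" by metis
  define c where "c = (\<lambda>x t. if x then b t else a t)"
  have E: "E t s \<longleftrightarrow> (\<exists>x. s = c x t)" for t s
  proof -
    have "E t s \<longleftrightarrow> s \<in> {a t, b t}" using ab[of t] by blast
    then show ?thesis by (auto simp: c_def ex_bool_eq)
  qed
  have c_inj: "c x t = c y t \<longleftrightarrow> x = y" for x y t
    using ab[of t] by (auto simp: c_def)
  define \<phi> where "\<phi> w = fold c w r" for w
  have \<phi>_snoc: "\<phi> (w @ [x]) = c x (\<phi> w)" for w x by (simp add: \<phi>_def)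
  have path: "path_to E r (\<phi> w) (map \<phi> (prefixes w))" for w
  proof (induction w rule: rev_induct)
    case Nil
    show ?case by (simp add: path_to_def \<phi>_def)
  next
    case (snoc x w)
    then show ?case
      by (auto simp: E path_to_def prefixes_snoc successively_append_iff \<phi>_snoc)
  qed
  have unique: "p = q" if "path_to E r t p" "path_to E r t q" for t p q
    using assms that unfolding infinite_binary_tree_def rooted_tree_def by blast
  have "t \<in> range \<phi>" if "path_to E r t p" for t p
    using that
  proof (induction p arbitrary: t rule: rev_induct)
    case Nil
    then show ?case by (simp add: path_to_def)
  next
    case (snoc x p)
    show ?case
    proof (cases "p = []")
      case True
      then have "t = \<phi> []" using snoc.prems by (auto simp: path_to_def \<phi>_def)
      then show ?thesis by simp
    next
      case False
      then have "path_to E r (last p) p" "E (last p) t"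
        using snoc.prems by (auto simp: path_to_def successively_append_iff)
      then obtain w y where "last p = \<phi> w" "t = c y (last p)"
        using snoc.IH[of "last p"] E[of "last p" t] by auto
      then have "t = \<phi> (w @ [y])" by (simp add: \<phi>_snoc)
      then show ?thesis by simp
    qed
  qed
  moreover have "\<exists>p. path_to E r t p" for t
    using assms unfolding infinite_binary_tree_def rooted_tree_def by blast
  ultimately have surj: "surj \<phi>" by blast
  \<comment> \<open>Injectivity of \<open>\<phi>\<close> is not yet available, so a word is
    recovered from its whole path: the shorter paths agree by induction, and distinct offspring
    reveal the last letter.\<close>
  have prefixes_inj: "v = w" if "map \<phi> (prefixes v) = map \<phi> (prefixes w)" for v w
    using that
  proof (induction v arbitrary: w rule: rev_induct)
    case Nil
    from Nil.prems have "length (map \<phi> (prefixes [])) = length (map \<phi> (prefixes w))" by (rule arg_cong)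
    then show ?case by simp
  next
    case (snoc x v)
    from snoc.prems have "length (map \<phi> (prefixes (v @ [x]))) = length (map \<phi> (prefixes w))"
      by (rule arg_cong)
    then have "w \<noteq> []" by auto
    then obtain u y where w: "w = u @ [y]" by (cases w rule: rev_cases) auto
    from snoc.prems have eq: "map \<phi> (prefixes v) = map \<phi> (prefixes u)" "\<phi> (v @ [x]) = \<phi> (u @ [y])"
      by (simp_all add: w prefixes_snoc)
    from eq(1) have "v = u" by (rule snoc.IH)
    then have "x = y" using eq(2) c_inj by (simp only: \<phi>_snoc)
    with \<open>v = u\<close> show ?case by (simp only: w)
  qed
  have inj: "inj \<phi>"
  proof (rule injI)
    fix v w assume "\<phi> v = \<phi> w"
    then have "path_to E r (\<phi> v) (map \<phi> (prefixes w))" using path[of w] by (simp only:)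
    with path[of v] have "map \<phi> (prefixes v) = map \<phi> (prefixes w)" by (rule unique)
    then show "v = w" by (rule prefixes_inj)
  qed
  have le: "tree_le E r (\<phi> v) (\<phi> w) \<longleftrightarrow> prefix v w" for v w
  proof -
    have "tree_le E r (\<phi> v) (\<phi> w) \<longleftrightarrow> \<phi> v \<in> set (map \<phi> (prefixes w))"
      unfolding tree_le_def using path[of w] unique[OF path[of w]] by blast
    also have "\<dots> \<longleftrightarrow> prefix v w" using inj by (auto simp: inj_image_mem_iff)
    finally show ?thesis .
  qed
  have "tree_order E r (\<phi> w) = length w" for w
  proof -
    have "{t. tree_less E r t (\<phi> w)} = \<phi> ` (set (prefixes w) - {w})"
    proof (intro set_eqI)
      fix t
      obtain v where "t = \<phi> v" using surj by blast
      then show "t \<in> {t. tree_less E r t (\<phi> w)} \<longleftrightarrow> t \<in> \<phi> ` (set (prefixes w) - {w})"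
        using inj by (auto simp: tree_less_def le inj_eq)
    qed
    then have "tree_order E r (\<phi> w) = card (set (prefixes w) - {w})"
      using card_image[OF inj_on_subset[OF inj]] by (simp add: tree_order_def)
    \<comment> \<open>A word has one more prefix than letters, itself included.\<close>
    also have "\<dots> = length w"
      by (simp add: card_Diff_singleton distinct_card[OF distinct_prefixes])
    finally show ?thesis .
  qed
  with inj surj le show thesis by (intro that[of \<phi>]) (auto simp: bij_def)
qed

subsection \<open>The covering\<close>

text \<open>Bounded finite sums of squares first yield summability; only then does the norm bound
  have content, as the infinite sum would otherwise default to 0.\<close>

lemma lp_norm_2_le_sqrt:
  fixes f :: "'a \<Rightarrow> real"
  assumes "\<And>F. finite F \<Longrightarrow> (\<Sum>t\<in>F. (f t)\<^sup>2) \<le> b"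
  shows "f \<in> lp_space 2" "lp_norm 2 f \<le> sqrt b"
proof -
  have sq: "\<bar>x\<bar> powr 2 = x\<^sup>2" for x :: real by simp
  have sm: "(\<lambda>t. (f t)\<^sup>2) summable_on UNIV"
    using assms by (intro nonneg_bdd_above_summable_on bdd_aboveI[of _ b]) auto
  then show "f \<in> lp_space 2" by (simp add: lp_space_def sq)
  have "(\<Sum>\<^sub>\<infinity>t. (f t)\<^sup>2) \<le> b" using sm assms by (intro infsum_le_finite_sums) auto
  moreover have "0 \<le> (\<Sum>\<^sub>\<infinity>t. (f t)\<^sup>2)" by (intro infsum_nonneg) auto
  ultimately show "lp_norm 2 f \<le> sqrt b"
    by (simp add: lp_norm_def sq powr_half_sqrt)
qed

lemma profilesI:
  assumes "\<And>s. 0 \<le> \<mu> s" "\<mu> summable_on UNIV" "infsum \<mu> UNIV \<le> 1"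
  shows "profile N \<mu> \<in> profiles N"
  using assms unfolding profiles_def by blast

text \<open>The positive and negative parts each have total mass at most 1 and are rounded
  separately. Since \<open>(x - y)^2 \<le> 2 * x^2 + 2 * y^2\<close>, their errors
  \<open>4 / N\<close> combine to \<open>16 / N\<close>.\<close>

lemma diff_profile_error_le:
  fixes \<mu> :: "bool list \<Rightarrow> real"
  assumes abs: "(\<lambda>s. \<bar>\<mu> s\<bar>) summable_on UNIV" "(\<Sum>\<^sub>\<infinity>s. \<bar>\<mu> s\<bar>) \<le> 1" and "0 < N"
  obtains p q where "p \<in> profiles N" "q \<in> profiles N"
    "\<And>F. finite F \<Longrightarrow> (\<Sum>w\<in>F. (subtree_mass \<mu> w / (real (length w) + 1)
       - (real (p w) - real (q w)) / N)\<^sup>2) \<le> 16 / N"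
proof -
  define P where "P s = max (\<mu> s) 0" for s
  define M where "M s = max (- \<mu> s) 0" for s
  have P: "0 \<le> P s" "P s \<le> \<bar>\<mu> s\<bar>" and M: "0 \<le> M s" "M s \<le> \<bar>\<mu> s\<bar>" and PM: "\<mu> s = P s - M s" for s
    by (auto simp: P_def M_def)
  have part: "f summable_on UNIV \<and> infsum f UNIV \<le> 1"
    if "\<And>s. 0 \<le> f s" "\<And>s. f s \<le> \<bar>\<mu> s\<bar>" for f
  proof -
    have "f summable_on UNIV"
      using that by (intro summable_on_comparison_test[OF abs(1)]) auto
    moreover from this have "infsum f UNIV \<le> (\<Sum>\<^sub>\<infinity>s. \<bar>\<mu> s\<bar>)"
      using that abs by (intro infsum_mono) auto
    ultimately show ?thesis using abs(2) by linarith
  qed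
  note P' = part[of P, OF P] and M' = part[of M, OF M]
  have "\<mu> summable_on UNIV" using abs(1) by (subst summable_on_iff_abs_summable_on_real) simp
  then have "subtree_mass (\<lambda>s. \<mu> s + M s) w = subtree_mass \<mu> w + subtree_mass M w" for w
    unfolding subtree_mass_def using M' by (intro infsum_add summable_on_prefixes) auto
  moreover have "(\<lambda>s. \<mu> s + M s) = P" by (simp add: PM)
  ultimately have mass: "subtree_mass \<mu> w = subtree_mass P w - subtree_mass M w" for w by simp
  let ?e = "\<lambda>f w. subtree_mass f w / (real (length w) + 1) - real (profile N f w) / N"
  show thesis
  proof (rule that[of "profile N P" "profile N M"])
    show "profile N P \<in> profiles N" "profile N M \<in> profiles N"
      using P(1) P' M(1) M' by (auto intro!: profilesI)
    fix F :: "bool list set" assume "finite F"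
    have "(\<Sum>w\<in>F. (subtree_mass \<mu> w / (real (length w) + 1)
        - (real (profile N P w) - real (profile N M w)) / N)\<^sup>2) = (\<Sum>w\<in>F. (?e P w - ?e M w)\<^sup>2)"
    proof -
      have "(x - y) / k - (a - b) / N = (x / k - a / N) - (y / k - b / N)" for x y k a b :: real
        by (simp add: diff_divide_distrib)
      then show ?thesis by (simp only: mass)
    qed
    also have "\<dots> \<le> (\<Sum>w\<in>F. 2 * (?e P w)\<^sup>2 + 2 * (?e M w)\<^sup>2)"
    proof (rule sum_mono)
      fix w
      have "(x - y)\<^sup>2 \<le> 2 * x\<^sup>2 + 2 * y\<^sup>2" for x y :: real
        using zero_le_power2[of "x + y"] by (simp add: power2_eq_square algebra_simps)
      then show "(?e P w - ?e M w)\<^sup>2 \<le> 2 * (?e P w)\<^sup>2 + 2 * (?e M w)\<^sup>2" .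
    qed
    also have "\<dots> = 2 * (\<Sum>w\<in>F. (?e P w)\<^sup>2) + 2 * (\<Sum>w\<in>F. (?e M w)\<^sup>2)"
      by (simp add: sum.distrib sum_distrib_left)
    also have "\<dots> \<le> 2 * (4 / N) + 2 * (4 / N)"
      using sum_profile_error_le[of P N F] sum_profile_error_le[of M N F]
        P(1) P' M(1) M' \<open>0 < N\<close> \<open>finite F\<close>
      by (intro add_mono mult_left_mono) simp_all
    finally show "(\<Sum>w\<in>F. (subtree_mass \<mu> w / (real (length w) + 1)
        - (real (profile N P w) - real (profile N M w)) / N)\<^sup>2) \<le> 16 / N"
      by simp
  qed
qed

lemma lp_space_2_finite_support:
  assumes "finite {t. f t \<noteq> 0}"
  shows "f \<in> lp_space 2"
proof -
  have "(\<lambda>t. \<bar>f t\<bar> powr 2) summable_on {t. f t \<noteq> 0}" using assms by (rule summable_on_finite)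
  then show ?thesis unfolding lp_space_def
    by (subst (asm) summable_on_cong_neutral[where T = UNIV and g = "\<lambda>t. \<bar>f t\<bar> powr 2"]) auto
qed

lemma lp_space_2_add:
  assumes "f \<in> lp_space 2" "g \<in> lp_space 2"
  shows "(\<lambda>t. f t + g t) \<in> lp_space 2"
proof -
  have "(\<lambda>t. 2 * (f t)\<^sup>2 + 2 * (g t)\<^sup>2) summable_on UNIV"
    using assms by (intro summable_on_add summable_on_cmult_right) (auto simp: lp_space_def)
  moreover have "(x + y)\<^sup>2 \<le> 2 * x\<^sup>2 + 2 * y\<^sup>2" for x y :: real
    using zero_le_power2[of "x - y"] by (simp add: power2_eq_square algebra_simps)
  ultimately have "(\<lambda>t. (f t + g t)\<^sup>2) summable_on UNIV"
    by (rule summable_on_comparison_test) auto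
  then show ?thesis by (simp add: lp_space_def)
qed

theorem corollary1p2:
  fixes E :: "'a \<Rightarrow> 'a \<Rightarrow> bool" and r :: 'a and \<alpha> \<sigma> :: "'a \<Rightarrow> real"
  assumes "infinite_binary_tree E r"
    and "\<And>t. \<sigma> t = 1"
    and "\<And>t. \<alpha> t = 1 / (real (tree_order E r t) + 1)"
  shows "\<exists>c::real. 0 < c \<and> (\<forall>n::nat. n \<ge> 1 \<longrightarrow>
    entropy_number (lp_space 1) (lp_norm 1) (lp_space 2) (lp_norm 2)
      (weighted_summation E r \<alpha> \<sigma>) n \<le> ereal (c * real n powr (- 1 / 2)))"
proof (intro exI[of _ 43] conjI allI impI)
  fix n :: nat assume "1 \<le> n"
  obtain \<phi> :: "bool list \<Rightarrow> 'a" where \<phi>: "bij \<phi>"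
    "\<And>v w. tree_le E r (\<phi> v) (\<phi> w) \<longleftrightarrow> prefix v w" "\<And>w. tree_order E r (\<phi> w) = length w"
    using infinite_binary_tree_words_iso[OF assms(1)] by blast
  have "inj \<phi>" "surj \<phi>" using \<phi>(1) by (auto simp: bij_def)
  define N where "N = real n / 112"
  have "0 < N" using \<open>1 \<le> n\<close> by (simp add: N_def)
  let ?V = "weighted_summation E r \<alpha> \<sigma>"
  have V: "?V \<mu> (\<phi> w) = subtree_mass (\<mu> \<circ> \<phi>) w / (real (length w) + 1)" for \<mu> w
  proof -
    have "bij_betw \<phi> {s. prefix w s} {t. tree_le E r (\<phi> w) t}"
      unfolding bij_betw_def
    proof (intro conjI set_eqI iffI)
      show "inj_on \<phi> {s. prefix w s}" by (rule inj_on_subset[OF \<open>inj \<phi>\<close>]) simp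
      fix t assume "t \<in> {t. tree_le E r (\<phi> w) t}"
      moreover obtain s where "t = \<phi> s" using surjD[OF \<open>surj \<phi>\<close>] by blast
      ultimately show "t \<in> \<phi> ` {s. prefix w s}" by (simp add: \<phi>(2))
    qed (auto simp: \<phi>(2))
    from infsum_reindex_bij_betw[OF this, of \<mu>]
    show ?thesis by (simp add: weighted_summation_def subtree_mass_def assms(2,3) \<phi>(3))
  qed
  \<comment> \<open>A pair of profiles, for the positive and the negative part, is carried from
    words to the tree by \<open>inv \<phi>\<close>.\<close>
  define centre where
    "centre = (\<lambda>(p, q) t. (real (p (inv \<phi> t)) - real (q (inv \<phi> t))) / N :: real)"
  have centre: "centre (p, q) (\<phi> w) = (real (p w) - real (q w)) / N" for p q w
    using \<open>inj \<phi>\<close> by (simp add: centre_def)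
  define C where "C = centre ` (profiles N \<times> profiles N)"
  have fin: "finite (profiles N)" using \<open>0 < N\<close> by (rule finite_profiles)
  have C_Y: "C \<subseteq> lp_space 2"
  proof -
    have "centre (p, q) \<in> lp_space 2" if pq: "p \<in> profiles N" "q \<in> profiles N" for p q
    proof (rule lp_space_2_finite_support, rule finite_subset)
      show "finite (\<phi> ` ({w. 0 < p w} \<union> {w. 0 < q w}))"
        using finite_support_profiles[OF pq(1) \<open>0 < N\<close>] finite_support_profiles[OF pq(2) \<open>0 < N\<close>]
        by simp
      show "{t. centre (p, q) t \<noteq> 0} \<subseteq> \<phi> ` ({w. 0 < p w} \<union> {w. 0 < q w})"
      proof
        fix t assume t: "t \<in> {t. centre (p, q) t \<noteq> 0}"
        obtain w where w: "t = \<phi> w" using surjD[OF \<open>surj \<phi>\<close>] by blast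
        have "0 < p w \<or> 0 < q w"
        proof (rule ccontr)
          assume "\<not> ?thesis"
          then have "centre (p, q) t = 0" by (simp add: centre w)
          then show False using t by simp
        qed
        then show "t \<in> \<phi> ` ({w. 0 < p w} \<union> {w. 0 < q w})" unfolding w by blast
      qed
    qed
    then show ?thesis by (auto simp: C_def)
  qed
  have C_card: "card C \<le> 2 ^ (n - 1)"
  proof -
    have "card C \<le> card (profiles N \<times> profiles N)" unfolding C_def using fin by (intro card_image_le) simp
    also have "\<dots> = (card (profiles N))\<^sup>2" by (simp add: card_cartesian_product power2_eq_square)
    also have "\<dots> \<le> 2 ^ (n - 1)" unfolding N_def using \<open>1 \<le> n\<close> by (rule card_profiles_square_le)
    finally show ?thesis .
  qed
  \<comment> \<open>The constant is found from \<open>16 * 112 = 1792 < 1849 = 43^2\<close>; open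
    balls require the strict inequality.\<close>
  have \<epsilon>: "sqrt (16 / N) < 43 * real n powr (- 1 / 2)"
  proof -
    have "16 / N < (43 / sqrt (real n))\<^sup>2"
      using \<open>1 \<le> n\<close> by (simp add: N_def power_divide divide_simps)
    then have "sqrt (16 / N) < 43 / sqrt (real n)" by (rule real_less_lsqrt[rotated]) simp
    moreover have "real n powr (- 1 / 2) = 1 / sqrt (real n)"
      by (simp add: powr_minus_divide powr_half_sqrt)
    ultimately show ?thesis by simp
  qed
  have cover: "?V ` {x \<in> lp_space 1. lp_norm 1 x \<le> 1}
      \<subseteq> (\<Union>c\<in>C. {y \<in> lp_space 2. lp_norm 2 (y - c) < 43 * real n powr (- 1 / 2)})"
  proof (intro image_subsetI)
    fix \<mu> :: "'a \<Rightarrow> real" assume \<mu>: "\<mu> \<in> {x \<in> lp_space 1. lp_norm 1 x \<le> 1}"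
    have "(\<lambda>t. \<bar>\<mu> t\<bar>) summable_on UNIV" "(\<Sum>\<^sub>\<infinity>t. \<bar>\<mu> t\<bar>) \<le> 1"
      using \<mu> infsum_nonneg[of UNIV "\<lambda>t. \<bar>\<mu> t\<bar>"] by (auto simp: lp_space_def lp_norm_def)
    then have "(\<lambda>s. \<bar>(\<mu> \<circ> \<phi>) s\<bar>) summable_on UNIV" "(\<Sum>\<^sub>\<infinity>s. \<bar>(\<mu> \<circ> \<phi>) s\<bar>) \<le> 1"
      using summable_on_reindex_bij_betw[OF \<phi>(1), of "\<lambda>t. \<bar>\<mu> t\<bar>"]
        infsum_reindex_bij_betw[OF \<phi>(1), of "\<lambda>t. \<bar>\<mu> t\<bar>"] by simp_all
    from diff_profile_error_le[OF this \<open>0 < N\<close>] obtain p q where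
      pq: "p \<in> profiles N" "q \<in> profiles N" and
      err: "\<And>F. finite F \<Longrightarrow> (\<Sum>w\<in>F. (subtree_mass (\<mu> \<circ> \<phi>) w / (real (length w) + 1)
         - (real (p w) - real (q w)) / N)\<^sup>2) \<le> 16 / N"
      by blast
    let ?c = "centre (p, q)"
    have "(\<Sum>t\<in>F. ((?V \<mu> - ?c) t)\<^sup>2) \<le> 16 / N" if "finite F" for F
    proof -
      have "bij_betw \<phi> (inv \<phi> ` F) F"
        using inj_on_subset[OF \<open>inj \<phi>\<close>] \<open>surj \<phi>\<close>
        by (intro bij_betw_imageI) (simp_all add: image_f_inv_f)
      from sum.reindex_bij_betw[OF this, of "\<lambda>t. ((?V \<mu> - ?c) t)\<^sup>2", symmetric]
      show ?thesis using err[of "inv \<phi> ` F"] that by (simp add: V centre)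
    qed
    note d = lp_norm_2_le_sqrt[OF this]
    have c: "?c \<in> C" using pq by (auto simp: C_def)
    \<comment> \<open>That the image lies in the target space is obtained only here, from its
      difference to a centre of finite support.\<close>
    then have "(\<lambda>t. (?V \<mu> - ?c) t + ?c t) \<in> lp_space 2"
      using d(1) C_Y by (intro lp_space_2_add) auto
    then have "?V \<mu> \<in> lp_space 2" by simp
    moreover have "lp_norm 2 (?V \<mu> - ?c) < 43 * real n powr (- 1 / 2)"
      using d(2) \<epsilon> by linarith
    ultimately show "?V \<mu> \<in> (\<Union>c\<in>C. {y \<in> lp_space 2. lp_norm 2 (y - c) < 43 * real n powr (- 1 / 2)})"
      using c by blast
  qed
  show "entropy_number (lp_space 1) (lp_norm 1) (lp_space 2) (lp_norm 2) ?V n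
      \<le> ereal (43 * real n powr (- 1 / 2))"
    unfolding entropy_number_def
  proof (rule Inf_lower, rule imageI, rule CollectI, intro conjI exI[of _ C])
    show "0 < 43 * real n powr (- 1 / 2)" using \<open>1 \<le> n\<close> by simp
    show "finite C" unfolding C_def using fin by simp
  qed (fact C_Y C_card cover)+
qed simp

end
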